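(* For every integer $d\ge 3$ there exists a non-Hamiltonian finite graph $G$ of diameter $d$ such that every ball of $G$ except $G$ itself is Hamiltonian; that is, for every vertex $u\in V(G)$ and every integer $r\ge 1$ with $G_r(u)\ne G$, the ball $G_r(u)$ is Hamiltonian.
   Context: Graphs have no loops or multiple edges. The diameter of $G$ is the greatest distance between any two vertices of $G$ (so a graph of diameter $d<\infty$ is connected). For a vertex $u$ of a graph $G$ and an integer $r\ge 0$, $M_r(u)$ is the set of vertices at distance at most $r$ from $u$ in $G$, and the ball $G_r(u)$ of radius $r$ centered at $u$ is the subgraph of $G$ induced by $M_r(u)$. A finite graph is Hamiltonian if it has a cycle (of length at least $3$) containing all its vertices. *)

theory Defs
  imports "Graph_Theory.Graph_Theory"
begin

(* Undirected simple graphs are the symmetric digraphs of the locale graph: finite, without loops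
   and without parallel arcs, an edge being a pair of opposite arcs. *)

(* Infinite if v is not reachable from u. *)
definition graph_dist :: "('a, 'b) pre_digraph \<Rightarrow> 'a \<Rightarrow> 'a \<Rightarrow> ereal" where
  "graph_dist G u v = wf_digraph.\<mu> G (\<lambda>_. 1) u v"

(* Minus infinity if G has no vertices, infinite if G is disconnected; for a nonempty finite graph
   the supremum is a maximum. *)
definition graph_diameter :: "('a, 'b) pre_digraph \<Rightarrow> ereal" where
  "graph_diameter G = (SUP u\<in>verts G. SUP v\<in>verts G. graph_dist G u v)"

definition graph_ball :: "('a, 'b) pre_digraph \<Rightarrow> 'a \<Rightarrow> nat \<Rightarrow> ('a, 'b) pre_digraph" where
  "graph_ball G u r = G \<restriction> {v \<in> verts G. graph_dist G u v \<le> ereal (real r)}"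

(* The library's cycle also admits u, v, u along the two arcs of an edge; in a graph, the bound on
   the length leaves exactly the undirected cycles. *)
definition hamiltonian :: "('a, 'b) pre_digraph \<Rightarrow> bool" where
  "hamiltonian G \<longleftrightarrow>
     (\<exists>u p. pre_digraph.awalk G u p u \<and> pre_digraph.cycle G p \<and> length p \<ge> 3 \<and>
        set (pre_digraph.awalk_verts G u p) = verts G)"

end

theory Submission
  imports Defs
begin

text \<open>
  Let \<open>n = d - 1\<close>. The graph is a chain of triangles \<open>T\<^sub>0, \<dots>, T\<^bsub>n-1\<^esub>\<close>, consecutive triangles being
  completely joined, together with independent sets \<open>Y\<^sub>0, \<dots>, Y\<^sub>n\<close>: every vertex of \<open>Y\<^sub>i\<close> is joined
  to all of \<open>T\<^bsub>i-1\<^esub>\<close> and \<open>T\<^sub>i\<close> (as far as they exist). The sets at the two ends have two vertices,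
  the others three, so there are \<open>3 n + 1\<close> independent vertices against \<open>3 n\<close> triangle vertices.
  A cycle cannot contain more vertices of an independent set than other vertices; therefore the graph
  is not Hamiltonian (\<open>hamiltonian_independent_card\<close>). The distance from \<open>Y\<^sub>0\<close> to \<open>Y\<^sub>n\<close> is
  \<open>n + 1 = d\<close>, and it is the largest one.

  The triangles transmit distances faster than the independent sets: a walk reaches
  \<open>T\<^sub>i\<close> before the vertices beyond it. So a ball that is not the whole graph is bounded on at least
  one side by a complete triangle whose outer neighbours are missing. The surplus vertex is
  thus lost, and there is even room to spare: run once up the chain, through two vertices of
  each triangle, and back down through the third ones. This cycle through the triangles of
  the ball has a distinct edge for each independent vertex of the ball such that the vertex is
  adjacent to both ends, and it is inserted there (\<open>hamiltonian_insert_after\<close>). When the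
  chain is cut on the right, edges are used as far to the left as possible, which makes room
  for \<open>Y\<^sub>0\<close>; when it is cut on the left, as far to the right as possible
  (\<open>hamiltonian_layers\<close>). The one ball of a different shape, that of radius 1 around an
  independent vertex, is a subcase because any part of the independent vertices may be inserted.
\<close>

section \<open>Graphs and distances\<close>

definition graph_on :: "('a \<Rightarrow> 'a \<Rightarrow> bool) \<Rightarrow> 'a set \<Rightarrow> ('a, 'a \<times> 'a) pre_digraph" where
  "graph_on E V = \<lparr>verts = V, arcs = {(v, w). v \<in> V \<and> w \<in> V \<and> E v w}, tail = fst, head = snd\<rparr>"

lemma graph_on_simps [simp]:
  "verts (graph_on E V) = V"
  "arcs (graph_on E V) = {(v, w). v \<in> V \<and> w \<in> V \<and> E v w}"
  "tail (graph_on E V) = fst"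
  "head (graph_on E V) = snd"
  by (simp_all add: graph_on_def)

lemma wf_graph_on: "wf_digraph (graph_on E V)"
  by unfold_locales auto

lemma graph_graph_on:
  assumes "finite V" "\<And>v w. E v w \<Longrightarrow> E w v" "\<And>v. \<not> E v v"
  shows "graph (graph_on E V)"
proof -
  have "finite (arcs (graph_on E V))"
    by (rule finite_subset[of _ "V \<times> V"]) (use assms in auto)
  then show ?thesis
    by unfold_locales (use assms in \<open>auto simp: arc_to_ends_def symmetric_conv\<close>)
qed

lemma graph_on_restrict: "U \<subseteq> V \<Longrightarrow> graph_on E V \<restriction> U = graph_on E U"
  by (auto simp: graph_on_def induce_subgraph_def)

lemma graph_dist_ge:
  assumes "wf_digraph G" "\<And>p. pre_digraph.awalk G u p v \<Longrightarrow> k \<le> length p"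
  shows "ereal (real k) \<le> graph_dist G u v"
proof -
  interpret wf_digraph G by fact
  have "awalk_cost (\<lambda>_. 1) p = real (length p)" for p
    by (induction p) auto
  then show ?thesis
    unfolding graph_dist_def \<mu>_def using assms(2) by (intro INF_greatest) auto
qed

text \<open>Walk lengths are natural numbers, so the infimum that defines the distance is attained
  unless it is infinite. This turns distances into walks, on which induction is possible.\<close>

lemma graph_dist_le_iff:
  assumes "wf_digraph G"
  shows "graph_dist G u v \<le> ereal (real r) \<longleftrightarrow> (\<exists>p. pre_digraph.awalk G u p v \<and> length p \<le> r)"
proof -
  interpret wf_digraph G by fact
  have cost: "awalk_cost (\<lambda>_. 1) p = real (length p)" for p
    by (induction p) auto
  show ?thesis
  proof
    assume le: "graph_dist G u v \<le> ereal (real r)"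
    show "\<exists>p. awalk u p v \<and> length p \<le> r"
    proof (rule ccontr)
      assume "\<nexists>p. awalk u p v \<and> length p \<le> r"
      then have "ereal (real (Suc r)) \<le> graph_dist G u v"
        by (intro graph_dist_ge assms) (auto simp: not_le Suc_le_eq)
      with le have "ereal (real (Suc r)) \<le> ereal (real r)" by (rule order_trans[rotated])
      then show False by simp
    qed
  next
    assume "\<exists>p. awalk u p v \<and> length p \<le> r"
    then obtain p where p: "awalk u p v" "length p \<le> r" by blast
    have "graph_dist G u v \<le> ereal (real (length p))"
      unfolding graph_dist_def using min_cost_le_walk_cost[OF p(1), of "\<lambda>_. 1"] by (simp add: cost)
    also have "\<dots> \<le> ereal (real r)" using p(2) by simp
    finally show "graph_dist G u v \<le> ereal (real r)" .
  qed
qed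

section \<open>Hamiltonian cycles\<close>

text \<open>In a Hamiltonian cycle the arcs that enter \<open>Y\<close> have different heads and different tails,
  they reach all of \<open>Y\<close>, and independence forces their tails to lie outside \<open>Y\<close>.\<close>

lemma hamiltonian_independent_card:
  assumes "wf_digraph G" "finite (verts G)" "hamiltonian G" "Y \<subseteq> verts G"
    and indep: "\<And>e. e \<in> arcs G \<Longrightarrow> \<not> (tail G e \<in> Y \<and> head G e \<in> Y)"
  shows "card Y \<le> card (verts G - Y)"
proof -
  interpret wf_digraph G by fact
  obtain u p where p: "awalk u p u" "cycle p" "length p \<ge> 3" "set (awalk_verts u p) = verts G"
    using assms(3) unfolding hamiltonian_def by blast
  have ne: "p \<noteq> []" using p(3) by auto
  have "tail G (hd p) = u" using p(1) ne by (cases p) (auto simp: awalk_def)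
  moreover have "head G (last p) = u"
    using p(1) ne awlast_of_awalk[OF p(1)] by (simp add: awalk_verts_conv)
  moreover have "cas u p u" using p(1) by (simp add: awalk_def)
  ultimately have vs: "awalk_verts u p = u # map (head G) p" "awalk_verts u p = map (tail G) p @ [u]"
    using ne awalk_verts_conv'[of u p u] awalk_verts_conv[of u p] by simp_all
  \<comment> \<open>Only the list of heads is distinct by definition. The walk is closed, so the tails are a
    permutation of the heads.\<close>
  have "mset (u # map (head G) p) = mset (map (tail G) p @ [u])"
    using vs by metis
  then have ms: "mset (map (head G) p) = mset (map (tail G) p)" by simp
  obtain u' where "distinct (tl (awalk_verts u' p))"
    using p(2) unfolding cycle_def by blast
  then have dh: "distinct (map (head G) p)"
    using awalk_verts_ne_eq[OF ne, of u' u] vs by simp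
  then have dt: "distinct (map (tail G) p)" using ms mset_eq_imp_distinct_iff by blast
  have seth: "set (map (head G) p) = verts G"
  proof -
    have "u \<in> set (map (tail G) p)" using p(1) ne by (cases p) (auto simp: awalk_def)
    then show ?thesis using p(4) vs(2) mset_eq_setD[OF ms] by auto
  qed
  then have sett: "set (map (tail G) p) = verts G" using mset_eq_setD[OF ms] by simp
  have arcs: "set p \<subseteq> arcs G" using p(1) by (auto simp: awalk_def)
  have "card Y \<le> card {e \<in> set p. head G e \<in> Y}"
  proof -
    have "Y \<subseteq> head G ` {e \<in> set p. head G e \<in> Y}" using seth assms(4) by auto
    then show ?thesis by (intro surj_card_le) auto
  qed
  also have "\<dots> \<le> card {e \<in> set p. tail G e \<in> verts G - Y}"
    using arcs indep by (intro card_mono) auto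
  also have "\<dots> = card (tail G ` {e \<in> set p. tail G e \<in> verts G - Y})"
    using dt by (intro card_image[symmetric]) (auto simp: distinct_map inj_on_def)
  also have "\<dots> \<le> card (verts G - Y)"
    using assms(2) by (intro card_mono) auto
  finally show ?thesis .
qed

lemma hamiltonian_graph_on:
  assumes "distinct xs" "length xs \<ge> 3" "successively E xs" "E (last xs) (hd xs)"
  shows "hamiltonian (graph_on E (set xs))"
proof -
  let ?G = "graph_on E (set xs)"
  interpret wf_digraph ?G by (rule wf_graph_on)
  have walk: "\<exists>p. awalk (hd ys) p z \<and> awalk_verts (hd ys) p = ys @ [z] \<and> length p = length ys"
    if "ys \<noteq> []" "set ys \<subseteq> set xs" "successively E ys" "E (last ys) z" "z \<in> set xs" for ys z
    using that
  proof (induction ys)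
    case (Cons y ys)
    show ?case
    proof (cases "ys = []")
      case True
      then show ?thesis using Cons.prems
        by (intro exI[of _ "[(y, z)]"]) (auto simp: awalk_def)
    next
      case False
      then obtain p where "awalk (hd ys) p z" "awalk_verts (hd ys) p = ys @ [z]" "length p = length ys"
        using Cons by (auto simp: successively_Cons)
      then show ?thesis using Cons.prems False
        by (intro exI[of _ "(y, hd ys) # p"]) (auto simp: awalk_Cons_iff successively_Cons)
    qed
  qed simp
  have ne: "xs \<noteq> []" using assms(2) by auto
  from walk[OF ne _ assms(3,4)] ne obtain p where
    p: "awalk (hd xs) p (hd xs)" "awalk_verts (hd xs) p = xs @ [hd xs]" "length p = length xs" by auto
  have "distinct (tl (awalk_verts (hd xs) p))"
    using p(2) assms(1) ne by (cases xs) auto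
  then have "cycle p" unfolding cycle_def using p ne by (intro exI[of _ "hd xs"]) auto
  then show ?thesis unfolding hamiltonian_def using p ne assms(2)
    by (intro exI[of _ "hd xs"] exI[of _ p]) auto
qed

text \<open>The only vertex that may be inserted after \<open>x\<close> is \<open>g x\<close>, and it is skipped if it is not in
  \<open>Y\<close>. One function \<open>g\<close> thus serves all subsets \<open>Y\<close> of its range.\<close>

definition insert_after :: "('a \<Rightarrow> 'a) \<Rightarrow> 'a set \<Rightarrow> 'a list \<Rightarrow> 'a list" where
  "insert_after g Y xs = concat (map (\<lambda>x. if g x \<in> Y then [x, g x] else [x]) xs)"

lemma insert_after_simps [simp]:
  "insert_after g Y [] = []"
  "insert_after g Y (x # xs) = (if g x \<in> Y then [x, g x] else [x]) @ insert_after g Y xs"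
  by (simp_all add: insert_after_def)

lemma set_insert_after: "set (insert_after g Y xs) = set xs \<union> (g ` set xs \<inter> Y)"
  by (induction xs) auto

lemma distinct_insert_after:
  "distinct xs \<Longrightarrow> inj_on g (set xs) \<Longrightarrow> set xs \<inter> Y = {} \<Longrightarrow> distinct (insert_after g Y xs)"
  by (induction xs) (auto simp: set_insert_after)

lemma hd_insert_after: "xs \<noteq> [] \<Longrightarrow> hd (insert_after g Y xs) = hd xs"
  by (cases xs) auto

lemma successively_insert_after:
  assumes "successively (\<lambda>x x'. E x x' \<and> E x (g x) \<and> E (g x) x') xs" "xs \<noteq> []"
    and "E (last xs) z" "E (last xs) (g (last xs))" "E (g (last xs)) z"
  shows "successively E (insert_after g Y xs) \<and> E (last (insert_after g Y xs)) z"
  using assms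
proof (induction xs)
  case (Cons x xs)
  show ?case
  proof (cases "xs = []")
    case False
    then have "insert_after g Y xs \<noteq> []" by (cases xs) auto
    then show ?thesis using Cons False
      by (auto simp: successively_Cons hd_insert_after)
  qed (use Cons.prems in auto)
qed simp

text \<open>Each \<open>g x\<close> is adjacent to both ends of the edge that leaves \<open>x\<close> in the cycle \<open>xs\<close>, so
  replacing that edge by the path through \<open>g x\<close> gives a cycle again. Injectivity of \<open>g\<close> ensures that
  no vertex is inserted twice.\<close>

lemma hamiltonian_insert_after:
  assumes "distinct xs" "length xs \<ge> 3"
    and "successively (\<lambda>x x'. E x x' \<and> E x (g x) \<and> E (g x) x') xs"
    and "E (last xs) (hd xs)" "E (last xs) (g (last xs))" "E (g (last xs)) (hd xs)"
    and "inj_on g (set xs)" "set xs \<inter> Y = {}" "Y \<subseteq> g ` set xs"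
  shows "hamiltonian (graph_on E (set xs \<union> Y))"
proof -
  let ?ys = "insert_after g Y xs"
  have ne: "xs \<noteq> []" using assms(2) by auto
  have "set ?ys = set xs \<union> Y" using assms(9) by (auto simp: set_insert_after)
  moreover have "length ?ys \<ge> length xs" by (induction xs) auto
  ultimately show ?thesis
    using hamiltonian_graph_on[of ?ys E] successively_insert_after[OF assms(3) ne assms(4-6), of Y]
      distinct_insert_after[OF assms(1,7,8)] assms(2) hd_insert_after[OF ne, of g Y]
    by auto
qed

section \<open>The chain of triangles\<close>

text \<open>The number \<open>v\<close> stands at position \<open>v div 3\<close> of the chain. The triangle \<open>T\<^sub>i\<close> is the set
  \<open>{6 i + 3, 6 i + 4, 6 i + 5}\<close> at position \<open>2 i + 1\<close>; the numbers \<open>6 i, 6 i + 1, 6 i + 2\<close> at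
  position \<open>2 i\<close> form \<open>Y\<^sub>i\<close>. On the vertex set \<open>{1..6 n + 1}\<close> exactly one vertex is cut off from
  \<open>Y\<^sub>0\<close> and from \<open>Y\<^sub>n\<close>, and all balls but those of radius 1 around independent vertices become
  intervals of numbers.\<close>

definition adj :: "nat \<Rightarrow> nat \<Rightarrow> bool" where
  "adj v w \<longleftrightarrow> v \<noteq> w \<and> (odd (v div 3) \<or> odd (w div 3)) \<and>
     v div 3 \<le> w div 3 + 2 \<and> w div 3 \<le> v div 3 + 2"

text \<open>The tour of the triangles \<open>T\<^sub>a, \<dots>, T\<^bsub>a+k\<^esub>\<close> uses \<open>6 i + 4\<close> and \<open>6 i + 3\<close> on its way up and
  \<open>6 i + 5\<close> on its way down. In this order the independent vertices that find a place in the tour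
  below fill an interval.\<close>

fun tour :: "nat \<Rightarrow> nat \<Rightarrow> nat list" where
  "tour a 0 = [6 * a + 4, 6 * a + 3, 6 * a + 5]"
| "tour a (Suc k) = [6 * a + 4, 6 * a + 3] @ tour (Suc a) k @ [6 * a + 5]"

lemma tour_not_Nil [simp]: "tour a k \<noteq> []"
  by (cases k) auto

lemma hd_tour: "hd (tour a k) = 6 * a + 4"
  by (cases k) auto

lemma last_tour: "last (tour a k) = 6 * a + 5"
  by (cases k) auto

lemma length_tour: "length (tour a k) = 3 * (k + 1)"
  by (induction k arbitrary: a) auto

lemma odd_div_3_iff:
  fixes x :: nat
  shows "odd (x div 3) \<longleftrightarrow> x = 6 * (x div 6) + 3 \<or> x = 6 * (x div 6) + 4 \<or> x = 6 * (x div 6) + 5"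
  by presburger

lemma set_tour: "set (tour a k) = {x. a \<le> x div 6 \<and> x div 6 \<le> a + k \<and> odd (x div 3)}"
proof -
  have layer: "odd (x div 3) \<and> x div 6 = i \<longleftrightarrow> x \<in> {6 * i + 3, 6 * i + 4, 6 * i + 5}" for x i :: nat
    unfolding odd_div_3_iff by auto
  have "set (tour a k) = (\<Union>i\<in>{a..a + k}. {6 * i + 3, 6 * i + 4, 6 * i + 5})"
  proof (induction k arbitrary: a)
    case (Suc k)
    have "{a..a + Suc k} = insert a {Suc a..Suc a + k}" by auto
    then show ?case by (simp only: tour.simps set_append Suc) auto
  qed auto
  also have "\<dots> = {x. a \<le> x div 6 \<and> x div 6 \<le> a + k \<and> odd (x div 3)}"
    unfolding set_eq_iff UN_iff layer[symmetric] by auto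
  finally show ?thesis .
qed

lemma tour_memI:
  assumes "a \<le> i" "i \<le> a + k"
  shows "6 * i + 3 \<in> set (tour a k)" "6 * i + 4 \<in> set (tour a k)" "6 * i + 5 \<in> set (tour a k)"
proof -
  have "odd ((6 * i + 3) div 3)" "odd ((6 * i + 4) div 3)" "odd ((6 * i + 5) div 3)"
    by presburger+
  then show "6 * i + 3 \<in> set (tour a k)" "6 * i + 4 \<in> set (tour a k)" "6 * i + 5 \<in> set (tour a k)"
    using assms by (simp_all add: set_tour)
qed

lemma distinct_tour: "distinct (tour a k)"
  by (induction k arbitrary: a) (auto simp: set_tour)

lemma successively_tour:
  assumes "\<And>i. Q (6 * i + 4) (6 * i + 3)" "\<And>i. Q (6 * i + 3) (6 * i + 10)"
    "\<And>i. Q (6 * i + 3) (6 * i + 5)" "\<And>i. Q (6 * i + 11) (6 * i + 5)"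
  shows "successively Q (tour a k)"
proof (induction k arbitrary: a)
  case 0
  show ?case using assms by simp
next
  case (Suc k)
  then show ?case using assms(1,2,4)[of a]
    by (auto simp: successively_append_iff successively_Cons hd_tour last_tour add.commute)
qed

lemma layer_cases:
  fixes x :: nat
  obtains (odd) j where "x div 3 = 2 * j + 1" "6 * j + 3 \<le> x" "x \<le> 6 * j + 5" "x div 6 = j"
    | (even) j where "x div 3 = 2 * j" "6 * j \<le> x" "x \<le> 6 * j + 2" "x div 6 = j"
proof (cases "odd (x div 3)")
  case True
  then have "x div 3 = 2 * (x div 6) + 1 \<and> 6 * (x div 6) + 3 \<le> x \<and> x \<le> 6 * (x div 6) + 5" by presburger
  then show ?thesis using odd by blast
next
  case False
  then have "x div 3 = 2 * (x div 6) \<and> 6 * (x div 6) \<le> x \<and> x \<le> 6 * (x div 6) + 2" by presburger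
  then show ?thesis using even by blast
qed

text \<open>The edge leaving \<open>x\<close> in the tour receives the vertex \<open>host up x\<close>, which is always next to \<open>x\<close>
  in the chain. The edge from \<open>T\<^sub>i\<close> to \<open>T\<^bsub>i+1\<^esub>\<close> and the one back must receive vertices
  between these triangles, but the edge inside \<open>T\<^sub>i\<close> on the way up may receive one from either
  side. The flag \<open>up\<close> makes this choice: it decides on which side of the tour two vertices find room
  beyond the last triangle.\<close>

definition host :: "bool \<Rightarrow> nat \<Rightarrow> nat" where
  "host up x = (if x mod 3 = 0 \<or> up \<and> x mod 3 = 1 then x + 3 else x - 3)"

lemma host_mod_3: "3 \<le> x \<Longrightarrow> host up x mod 3 = x mod 3"
  by (auto simp: host_def le_mod_geq)

text \<open>The residue modulo 3 is preserved, and it determines the direction of the shift.\<close>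

lemma inj_on_host: "inj_on (host up) {3..}"
proof (rule inj_onI)
  fix x y assume "x \<in> {3..}" "y \<in> {3..}" "host up x = host up y"
  moreover from this have "x mod 3 = y mod 3" using host_mod_3 by (metis atLeast_iff)
  ultimately show "x = y" by (auto simp: host_def split: if_splits)
qed

lemma tour_ge_3: "x \<in> set (tour a k) \<Longrightarrow> 3 \<le> x"
  by (cases x rule: layer_cases) (auto simp: set_tour)

text \<open>The tour has \<open>3 (k + 1)\<close> edges. The independent vertices between its triangles take \<open>3 k\<close> of
  them, so three edges are left for vertices beyond the first or the last triangle. The
  alternatives are the ranges of the two host functions: \<open>up = False\<close> makes room for two vertices
  below \<open>T\<^sub>a\<close>, as a ball containing \<open>Y\<^sub>0\<close> needs, and \<open>up = True\<close> for two vertices above \<open>T\<^bsub>a+k\<^esub>\<close>. Only the whole graph would need both.\<close>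

lemma hamiltonian_layers:
  assumes even: "\<And>y. y \<in> Y \<Longrightarrow> even (y div 3)"
    and range: "Y \<subseteq> {6 * a + 1..6 * (a + k) + 6} \<or> Y \<subseteq> {6 * a + 2..6 * (a + k) + 7}"
  shows "hamiltonian (graph_on adj ({x. a \<le> x div 6 \<and> x div 6 \<le> a + k \<and> odd (x div 3)} \<union> Y))"
proof -
  obtain up where up: "Y \<subseteq> {6 * a + (if up then 2 else 1)..6 * (a + k) + (if up then 7 else 6)}"
    using range by (metis (full_types))
  have hosts: "host up (6 * i + 3) = 6 * i + 6" "host up (6 * i + 5) = 6 * i + 2"
    "host up (6 * i + 11) = 6 * i + 8" "host up (6 * i + 4) = 6 * i + (if up then 7 else 1)" for i
  proof -
    have "(6 * i + 3) mod 3 = 0" "(6 * i + 4) mod 3 = 1" "(6 * i + 5) mod 3 = 2" "(6 * i + 11) mod 3 = 2"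
      by presburger+
    then show "host up (6 * i + 3) = 6 * i + 6" "host up (6 * i + 5) = 6 * i + 2"
      "host up (6 * i + 11) = 6 * i + 8" "host up (6 * i + 4) = 6 * i + (if up then 7 else 1)"
      by (simp_all add: host_def)
  qed
  have pos: "(6 * i + 1) div 3 = 2 * i" "(6 * i + 2) div 3 = 2 * i" "(6 * i + 3) div 3 = 2 * i + 1"
    "(6 * i + 4) div 3 = 2 * i + 1" "(6 * i + 5) div 3 = 2 * i + 1" "(6 * i + 6) div 3 = 2 * i + 2"
    "(6 * i + 7) div 3 = 2 * i + 2" "(6 * i + 8) div 3 = 2 * i + 2" "(6 * i + 10) div 3 = 2 * i + 3"
    "(6 * i + 11) div 3 = 2 * i + 3" for i :: nat
    by presburger+
  have "hamiltonian (graph_on adj (set (tour a k) \<union> Y))"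
  proof (rule hamiltonian_insert_after[where g = "host up"])
    show "successively (\<lambda>x x'. adj x x' \<and> adj x (host up x) \<and> adj (host up x) x') (tour a k)"
      by (rule successively_tour; simp only: adj_def hosts pos; cases up;
          (simp only: if_True if_False pos)?; simp)
    show "inj_on (host up) (set (tour a k))"
      by (rule inj_on_subset[OF inj_on_host]) (auto dest: tour_ge_3)
    show "Y \<subseteq> host up ` set (tour a k)"
    proof
      fix y assume y: "y \<in> Y"
      have range_y: "6 * a + (if up then 2 else 1) \<le> y" "y \<le> 6 * (a + k) + (if up then 7 else 6)"
        using up y by auto
      obtain j where j: "6 * j \<le> y" "y \<le> 6 * j + 2"
        using even[OF y] by (cases y rule: layer_cases) auto
      \<comment> \<open>The residue of \<open>y\<close> modulo 6 tells which edge receives it.\<close>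
      then consider "y = 6 * (j - 1) + 6" "1 \<le> j" | "y = 6 * (j - 1) + 7" "up" "1 \<le> j"
        | "y = 6 * j + 1" "\<not> up" | "y = 6 * j + 2"
        using range_y by (cases "j = 0"; cases up) (simp; arith)+
      then show "y \<in> host up ` set (tour a k)"
      proof cases
        case 1
        then have "y = host up (6 * (j - 1) + 3)" by (simp add: hosts)
        moreover have "6 * (j - 1) + 3 \<in> set (tour a k)"
          using range_y 1 by (intro tour_memI; cases up; simp)
        ultimately show ?thesis by blast
      next
        case 2
        then have "y = host up (6 * (j - 1) + 4)" using hosts(4)[of "j - 1"] by simp
        moreover have "6 * (j - 1) + 4 \<in> set (tour a k)"
          using range_y 2 by (intro tour_memI; simp)
        ultimately show ?thesis by blast
      next
        case 3
        then have "y = host up (6 * j + 4)" using hosts(4)[of j] by simp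
        moreover have "6 * j + 4 \<in> set (tour a k)"
          using range_y 3 by (intro tour_memI; simp)
        ultimately show ?thesis by blast
      next
        case 4
        then have "y = host up (6 * j + 5)" by (simp add: hosts)
        moreover have "6 * j + 5 \<in> set (tour a k)"
          using range_y 4 by (intro tour_memI; cases up; simp)
        ultimately show ?thesis by blast
      qed
    qed
    show "adj (last (tour a k)) (hd (tour a k))"
      "adj (last (tour a k)) (host up (last (tour a k)))"
      "adj (host up (last (tour a k))) (hd (tour a k))"
      by (simp only: hd_tour last_tour hosts pos adj_def; simp)+
  qed (use even in \<open>auto simp: distinct_tour length_tour set_tour\<close>)
  then show ?thesis by (simp add: set_tour)
qed

lemma hamiltonian_interval:
  assumes "a \<le> b"
    and "6 * a + 1 \<le> l \<and> l \<le> 6 * a + 3 \<and> 6 * b + 5 \<le> u \<and> u \<le> 6 * b + 6 \<or>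
      6 * a + 2 \<le> l \<and> l \<le> 6 * a + 3 \<and> 6 * b + 5 \<le> u \<and> u \<le> 6 * b + 7"
  shows "hamiltonian (graph_on adj {l..u})"
proof -
  let ?S = "{x. a \<le> x div 6 \<and> x div 6 \<le> a + (b - a) \<and> odd (x div 3)}"
  let ?Y = "{y \<in> {l..u}. even (y div 3)}"
  have "hamiltonian (graph_on adj (?S \<union> ?Y))"
    by (rule hamiltonian_layers) (use assms in auto)
  moreover have "x \<in> ?S \<union> ?Y \<longleftrightarrow> x \<in> {l..u}" for x
    using assms by (cases x rule: layer_cases) auto
  then have "?S \<union> ?Y = {l..u}" by blast
  ultimately show ?thesis by simp
qed

text \<open>An interval that starts and ends with a triangle, restricted to the vertex set of the graph,
  keeps the triangle at one of its ends unless it covers the whole vertex set. In the remaining cases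
  \<open>hamiltonian_interval\<close> applies.\<close>

lemma hamiltonian_window:
  fixes a b r n :: nat
  assumes "a < b + r" "a < n + r" "1 \<le> b" "1 \<le> n"
    and "{w \<in> {1..6 * n + 1}. 6 * a + 3 \<le> w + 6 * r \<and> w < 6 * b} \<noteq> {1..6 * n + 1}" (is "?W \<noteq> _")
  shows "hamiltonian (graph_on adj ?W)"
proof -
  consider "r \<le> a" "b \<le> n" | "r \<le> a" "n < b" | "a < r" "b \<le> n" | "a < r" "n < b"
    by linarith
  then show ?thesis
  proof cases
    case 1
    then have "?W = {6 * (a - r) + 3..6 * (b - 1) + 5}" using assms(1-4) by auto
    then show ?thesis using assms(1-4) 1 hamiltonian_interval[of "a - r" "b - 1"] by auto
  next
    case 2
    then have "?W = {6 * (a - r) + 3..6 * (n - 1) + 7}" using assms(1-4) by auto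
    then show ?thesis using assms(1-4) 2 hamiltonian_interval[of "a - r" "n - 1"] by auto
  next
    case 3
    then have "?W = {1..6 * (b - 1) + 5}" using assms(1-4) by auto
    then show ?thesis using assms(1-4) 3 hamiltonian_interval[of 0 "b - 1"] by auto
  next
    case 4
    then have "?W = {1..6 * n + 1}" using assms(1-4) by auto
    with assms(5) show ?thesis by blast
  qed
qed

section \<open>Distances and balls\<close>

text \<open>Distance at most \<open>r\<close> in closed form. A step advances by at most two positions, and a
  step from or to an independent vertex by one only; two independent vertices therefore need one extra step,
  which also accounts for the distance 2 between two vertices of the same \<open>Y\<^sub>i\<close>. For an
  independent vertex and a triangle vertex the positions differ by an odd number, so the bound
  \<open>2 r\<close> is the same as \<open>2 r - 1\<close>.\<close>

definition near :: "nat \<Rightarrow> nat \<Rightarrow> nat \<Rightarrow> bool" where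
  "near r v w \<longleftrightarrow> v = w \<or>
     1 \<le> r \<and> (odd (v div 3) \<or> odd (w div 3)) \<and> v div 3 \<le> w div 3 + 2 * r \<and> w div 3 \<le> v div 3 + 2 * r \<or>
     2 \<le> r \<and> v div 3 + 2 \<le> w div 3 + 2 * r \<and> w div 3 + 2 \<le> v div 3 + 2 * r"

lemma near_mono: "near r v w \<Longrightarrow> r \<le> r' \<Longrightarrow> near r' v w"
  unfolding near_def by auto

lemma near_Suc:
  assumes "adj v x" "near r x w"
  shows "near (Suc r) v w"
proof -
  define p q s where "p = v div 3" and "q = w div 3" and "s = x div 3"
  have ps: "odd p \<or> odd s" "p \<le> s + 2" "s \<le> p + 2"
    using assms(1) by (simp_all add: adj_def p_def s_def)
  have goal: "near (Suc r) v w \<longleftrightarrow> v = w \<or>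
      (odd p \<or> odd q) \<and> p \<le> q + 2 * r + 2 \<and> q \<le> p + 2 * r + 2 \<or>
      1 \<le> r \<and> p \<le> q + 2 * r \<and> q \<le> p + 2 * r"
    by (simp add: near_def p_def q_def)
  from assms(2) consider "x = w"
    | "1 \<le> r" "odd s \<or> odd q" "s \<le> q + 2 * r" "q \<le> s + 2 * r"
    | "1 \<le> r" "s + 2 \<le> q + 2 * r" "q + 2 \<le> s + 2 * r"
    unfolding near_def s_def[symmetric] q_def[symmetric] by linarith
  then show ?thesis
  proof cases
    case 1
    then have "s = q" by (simp add: s_def q_def)
    with ps show ?thesis unfolding goal by simp
  next
    case 2
    show ?thesis
    proof (cases "odd p \<or> odd q")
      case True
      have "p \<le> q + 2 * r + 2" "q \<le> p + 2 * r + 2" using ps 2 by linarith+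
      with True show ?thesis unfolding goal by simp
    next
      case False
      \<comment> \<open>A walk between two independent vertices: its first step advances by one position only, and
        parity sharpens the bound for the remaining \<open>r\<close> steps by one.\<close>
      then obtain i k where i: "p = 2 * i" "q = 2 * k" by (auto elim!: evenE)
      obtain j where j: "s = 2 * j + 1" using False ps(1) by (auto elim!: oddE)
      have "i \<le> j + 1" "j \<le> i" "j + 1 \<le> k + r" "k \<le> j + r" using ps(2,3) 2(3,4) i j by presburger+
      then have "p \<le> q + 2 * r" "q \<le> p + 2 * r" using i by presburger+
      with 2(1) show ?thesis unfolding goal by simp
    qed
  next
    case 3
    then have "p \<le> q + 2 * r" "q \<le> p + 2 * r" using ps by linarith+
    with 3(1) show ?thesis unfolding goal by simp
  qed
qed

text \<open>If \<open>w\<close> is neither \<open>v\<close> nor adjacent to it, then moving to a triangle in the direction of \<open>w\<close> brings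
  \<open>w\<close> one step closer: the neighbouring triangle if \<open>v\<close> is independent, the next triangle in the chain
  otherwise. If both are independent vertices of the same \<open>Y\<^sub>i\<close>, either neighbouring triangle will do,
  and at least one exists.\<close>

lemma near_SucE:
  assumes "near (Suc r) v w" "v \<noteq> w" "\<not> adj v w" "v \<in> {1..6 * n + 1}" "w \<in> {1..6 * n + 1}" "1 \<le> n"
  obtains x where "x \<in> {1..6 * n + 1}" "adj v x" "near r x w"
proof -
  note step = that
  define p q where "p = v div 3" and "q = w div 3"
  have v: "3 * p \<le> v" "v \<le> 3 * p + 2" "1 \<le> v" and bounds: "p \<le> 2 * n" "q \<le> 2 * n"
    using assms(4,5) by (auto simp: p_def q_def)
  have r: "1 \<le> r"
    using assms(1-3) by (cases r) (auto simp: near_def adj_def)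
  have near: "(odd p \<or> odd q) \<and> p \<le> q + 2 * r + 2 \<and> q \<le> p + 2 * r + 2 \<or> p \<le> q + 2 * r \<and> q \<le> p + 2 * r"
    using assms(1,2) by (auto simp: near_def p_def q_def)
  have far: "even p \<or> q > p + 2 \<or> p > q + 2"
    using assms(2,3) by (auto simp: adj_def p_def q_def)
  have toward: thesis
    if "x div 3 = s" "odd s" "s \<le> 2 * n" "x \<noteq> v" "p \<le> s + 2" "s \<le> p + 2"
      "s \<le> q + 2 * r" "q \<le> s + 2 * r" for x s
  proof (rule step)
    from that(2,3) have "s + 1 \<le> 2 * n" "1 \<le> s" by presburger+
    moreover have "3 * s \<le> x" "x \<le> 3 * s + 2" unfolding that(1)[symmetric] by presburger+
    ultimately show "x \<in> {1..6 * n + 1}" by simp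
    show "adj v x" using that by (simp add: adj_def p_def)
    show "near r x w" using that r by (simp add: near_def q_def)
  qed
  show thesis
  proof (cases "even p")
    case True
    have close: "p \<le> q + 2 * r + 1" "q \<le> p + 2 * r + 1" using near True by presburger+
    show thesis
    proof (cases "p < q \<or> p = q \<and> p < 2 * n")
      case True
      then have "p \<le> q" "p + 1 \<le> 2 * n" using bounds by linarith+
      moreover have "(v + 3) div 3 = p + 1" by (simp add: p_def)
      ultimately show thesis
        using \<open>even p\<close> close r by (intro toward[of "v + 3" "p + 1"]) simp_all
    next
      case False
      then have p: "2 \<le> p" using \<open>even p\<close> bounds assms(6) by presburger
      then obtain u where u: "v = u + 3" using v(1) le_Suc_ex[of 3 v] by (auto simp: add.commute)
      then have s: "p = u div 3 + 1" by (simp add: p_def)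
      have "q \<le> p" using False by simp
      show thesis
        using \<open>even p\<close> \<open>q \<le> p\<close> u bounds close r by (intro toward[of u "u div 3"]) (simp_all add: s)
    qed
  next
    case False
    then have "p \<le> q + 2 * r + 2" "q \<le> p + 2 * r + 2" "p + 2 < q \<or> q + 2 < p"
      using near far by auto
    then consider "p + 2 < q" "q \<le> p + 2 * r + 2" | "q + 2 < p" "p \<le> q + 2 * r + 2" by blast
    then show thesis
    proof cases
      case 1
      have "(v + 6) div 3 = p + 2" by (simp add: p_def)
      then show thesis
        using \<open>odd p\<close> bounds 1 by (intro toward[of "v + 6" "p + 2"]) simp_all
    next
      case 2
      then obtain u where u: "v = u + 6" using v(1) le_Suc_ex[of 6 v] by (auto simp: add.commute)
      then have "u div 3 = p - 2" by (simp add: p_def)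
      then show thesis
        using \<open>odd p\<close> u bounds 2 by (intro toward[of u "p - 2"]) simp_all
    qed
  qed
qed

lemma graph_dist_chain:
  assumes "1 \<le> n" "v \<in> {1..6 * n + 1}" "w \<in> {1..6 * n + 1}"
  shows "graph_dist (graph_on adj {1..6 * n + 1}) v w \<le> ereal (real r) \<longleftrightarrow> near r v w"
proof -
  define V where "V = {1..6 * n + 1}"
  have V: "v \<in> V" "w \<in> V" using assms(2,3) by (auto simp: V_def)
  let ?G = "graph_on adj V"
  interpret wf_digraph ?G by (rule wf_graph_on)
  have "near (length p) v w" if "awalk v p w" for p v
    using that
  proof (induction p arbitrary: v)
    case Nil
    then show ?case by (auto simp: awalk_Nil_iff near_def)
  next
    case (Cons e p)
    then show ?case by (cases e) (auto simp: awalk_Cons_iff intro: near_Suc)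
  qed
  moreover have "\<exists>p. awalk v p w \<and> length p \<le> r" if "near r v w" "v \<in> V" for v r
    using that
  proof (induction r arbitrary: v)
    case 0
    then show ?case by (auto simp: near_def awalk_Nil_iff)
  next
    case (Suc r)
    consider "v = w" | "adj v w" | "v \<noteq> w" "\<not> adj v w" by blast
    then show ?case
    proof cases
      case 1
      then show ?thesis using V by (intro exI[of _ "[]"]) (auto simp: awalk_Nil_iff)
    next
      case 2
      then show ?thesis using V Suc.prems
        by (intro exI[of _ "[(v, w)]"]) (auto simp: awalk_Cons_iff awalk_Nil_iff)
    next
      case 3
      obtain x where x: "x \<in> V" "adj v x" "near r x w"
        using near_SucE[OF Suc.prems(1) 3 _ assms(3,1)] Suc.prems(2) unfolding V_def .
      then obtain p where "awalk x p w" "length p \<le> r" using Suc.IH by blast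
      then show ?thesis using x Suc.prems
        by (intro exI[of _ "(v, x) # p"]) (auto simp: awalk_Cons_iff)
    qed
  qed
  ultimately show ?thesis
    unfolding V_def[symmetric] graph_dist_le_iff[OF wf_digraph] using V near_mono by blast
qed

text \<open>Every ball is a window of the chain that is bounded by triangles: the triangles reach \<open>r\<close> steps to
  either side, and the independent vertices at distance \<open>r\<close> lie between them. The exception is radius 1
  around an independent vertex, where the other vertices of the same \<open>Y\<^sub>i\<close>, at distance 2, are
  missing.\<close>

lemma hamiltonian_ball:
  assumes "1 \<le> n" "v \<in> {1..6 * n + 1}" "1 \<le> r"
    and "{w \<in> {1..6 * n + 1}. near r v w} \<noteq> {1..6 * n + 1}" (is "?B \<noteq> _")
  shows "hamiltonian (graph_on adj ?B)"
proof (cases v rule: layer_cases)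
  case (odd c)
  have "near r v w \<longleftrightarrow> 6 * c + 3 \<le> w + 6 * r \<and> w < 6 * (c + r + 1)" for w
  proof (cases w rule: layer_cases)
    case (odd j)
    have "near r v w \<longleftrightarrow> c \<le> j + r \<and> j \<le> c + r"
    proof (cases "v = w")
      case True
      then show ?thesis using \<open>v div 6 = c\<close> \<open>w div 6 = j\<close> by (simp add: near_def)
    next
      case False
      then show ?thesis
        unfolding near_def \<open>v div 3 = 2 * c + 1\<close> \<open>w div 3 = 2 * j + 1\<close> using assms(3) by auto
    qed
    also have "\<dots> \<longleftrightarrow> 6 * c + 3 \<le> w + 6 * r \<and> w < 6 * (c + r + 1)"
      using odd(2,3) by presburger
    finally show ?thesis .
  next
    case (even j)
    have "2 * c + 1 \<noteq> 2 * j" by presburger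
    then have "v \<noteq> w" using \<open>v div 3 = 2 * c + 1\<close> even(1) by metis
    then have "near r v w \<longleftrightarrow> c + 1 \<le> j + r \<and> j \<le> c + r"
      unfolding near_def \<open>v div 3 = 2 * c + 1\<close> even(1) using assms(3) by (simp; linarith)
    also have "\<dots> \<longleftrightarrow> 6 * c + 3 \<le> w + 6 * r \<and> w < 6 * (c + r + 1)"
      using even(2,3) by presburger
    finally show ?thesis .
  qed
  then have B: "?B = {w \<in> {1..6 * n + 1}. 6 * c + 3 \<le> w + 6 * r \<and> w < 6 * (c + r + 1)}" by simp
  have "c < n + r" using odd(2) assms(2,3) by auto
  with assms(4) show ?thesis
    unfolding B using assms(1) by (intro hamiltonian_window) simp_all
next
  case (even c)
  show ?thesis
  proof (cases "r = 1")
    case False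
    then have r: "2 \<le> r" using assms(3) by simp
    have "near r v w \<longleftrightarrow> 6 * c + 3 \<le> w + 6 * r \<and> w < 6 * (c + r)" for w
    proof (cases w rule: layer_cases)
      case (odd j)
      have "2 * c \<noteq> 2 * j + 1" by presburger
      then have "v \<noteq> w" using \<open>v div 3 = 2 * c\<close> odd(1) by metis
      then have "near r v w \<longleftrightarrow> c \<le> j + r \<and> j + 1 \<le> c + r"
        unfolding near_def \<open>v div 3 = 2 * c\<close> odd(1) using r by (simp; linarith)
      also have "\<dots> \<longleftrightarrow> 6 * c + 3 \<le> w + 6 * r \<and> w < 6 * (c + r)"
        using odd(2,3) by presburger
      finally show ?thesis .
    next
      case (even j)
      have "near r v w \<longleftrightarrow> c + 1 \<le> j + r \<and> j + 1 \<le> c + r"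
      proof (cases "v = w")
        case True
        then show ?thesis using \<open>v div 6 = c\<close> \<open>w div 6 = j\<close> r by (simp add: near_def)
      next
        case False
        then show ?thesis
          unfolding near_def \<open>v div 3 = 2 * c\<close> \<open>w div 3 = 2 * j\<close> using r by auto
      qed
      also have "\<dots> \<longleftrightarrow> 6 * c + 3 \<le> w + 6 * r \<and> w < 6 * (c + r)"
        using even(2,3) by presburger
      finally show ?thesis .
    qed
    then have B: "?B = {w \<in> {1..6 * n + 1}. 6 * c + 3 \<le> w + 6 * r \<and> w < 6 * (c + r)}" by simp
    have "c < n + r" using even(2) assms(2) r by auto
    with assms(4) show ?thesis
      unfolding B using assms(1) r by (intro hamiltonian_window) simp_all
  next
    case True
    \<comment> \<open>A vertex of \<open>Y\<^sub>0\<close> or \<open>Y\<^sub>n\<close> has a single neighbouring triangle. For \<open>c = 0\<close> the truncated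
      difference \<open>c - 1\<close> is the index of that triangle.\<close>
    define k where "k = (if c = 0 \<or> c = n then 0 else 1 :: nat)"
    have c: "c \<le> n" using even(2) assms(2) by auto
    have "w \<in> ?B \<longleftrightarrow> w \<in> {x. c - 1 \<le> x div 6 \<and> x div 6 \<le> c - 1 + k \<and> odd (x div 3)} \<union> {v}" for w
    proof (cases w rule: layer_cases)
      case (odd j)
      have "2 * c \<noteq> 2 * j + 1" by presburger
      then have "v \<noteq> w" using \<open>v div 3 = 2 * c\<close> odd(1) by metis
      then have "near r v w \<longleftrightarrow> c \<le> j + 1 \<and> j \<le> c"
        unfolding near_def \<open>v div 3 = 2 * c\<close> odd(1) True by (simp; linarith)
      moreover have "w \<in> {1..6 * n + 1} \<longleftrightarrow> j < n" using odd(2,3) by auto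
      moreover have "c \<le> j + 1 \<and> j \<le> c \<and> j < n \<longleftrightarrow> c - 1 \<le> j \<and> j \<le> c - 1 + k"
        using c assms(1) by (auto simp: k_def)
      ultimately show ?thesis using \<open>v \<noteq> w\<close> odd(1,4) by auto
    next
      case (even j)
      have "near r v w \<longleftrightarrow> v = w"
        unfolding near_def \<open>v div 3 = 2 * c\<close> \<open>w div 3 = 2 * j\<close> True by simp
      then show ?thesis using even(1) assms(2) by auto
    qed
    then have B: "?B = {x. c - 1 \<le> x div 6 \<and> x div 6 \<le> c - 1 + k \<and> odd (x div 3)} \<union> {v}" by blast
    show ?thesis
      unfolding B using even(1-3) assms(1,2) c
      by (intro hamiltonian_layers) (auto simp: k_def)
  qed
qed

section \<open>The theorem\<close>

lemma card_layers:
  assumes "1 \<le> n"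
  shows "card {x \<in> {1..6 * n + 1}. odd (x div 3)} = 3 * n"
proof -
  have "x \<in> set (tour 0 (n - 1)) \<longleftrightarrow> x \<in> {x \<in> {1..6 * n + 1}. odd (x div 3)}" for x
  proof (cases x rule: layer_cases)
    case (odd j)
    have "x \<in> {1..6 * n + 1} \<longleftrightarrow> j < n" using odd(2,3) by auto
    then show ?thesis using odd(1,4) assms by (auto simp: set_tour)
  qed (simp add: set_tour)
  then have "{x \<in> {1..6 * n + 1}. odd (x div 3)} = set (tour 0 (n - 1))" by blast
  then show ?thesis
    using assms distinct_card[OF distinct_tour[of 0 "n - 1"]] by (simp add: length_tour)
qed

theorem theorem3p3:
  fixes d :: nat
  assumes "d \<ge> 3"
  shows "\<exists>G :: (nat, nat \<times> nat) pre_digraph.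
    graph G \<and> \<not> hamiltonian G \<and> graph_diameter G = ereal (real d) \<and>
    (\<forall>u\<in>verts G. \<forall>r::nat. r \<ge> 1 \<and> graph_ball G u r \<noteq> G \<longrightarrow> hamiltonian (graph_ball G u r))"
proof -
  define n where "n = d - 1"
  have n: "1 \<le> n" "d = Suc n" using assms by (auto simp: n_def)
  let ?V = "{1..6 * n + 1}"
  let ?G = "graph_on adj ?V"
  note dist = graph_dist_chain[OF n(1)]
  have "graph ?G"
    by (rule graph_graph_on) (auto simp: adj_def)
  moreover have "\<not> hamiltonian ?G"
  proof
    let ?S = "{x \<in> ?V. odd (x div 3)}"
    assume "hamiltonian ?G"
    then have "card (?V - ?S) \<le> card (?V - (?V - ?S))"
      using hamiltonian_independent_card[OF wf_graph_on, of adj ?V "?V - ?S"]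
      by (auto simp: adj_def)
    also have "?V - (?V - ?S) = ?S" by blast
    also have "card (?V - ?S) = card ?V - card ?S" by (rule card_Diff_subset) auto
    finally show False using card_layers[OF n(1)] by simp
  qed
  moreover have "graph_diameter ?G = ereal (real d)"
  proof (rule antisym)
    have "near d v w" if "v \<in> ?V" "w \<in> ?V" for v w
    proof -
      have "v div 3 \<le> 2 * n" "w div 3 \<le> 2 * n" using that by auto
      then show ?thesis using n assms by (auto simp: near_def)
    qed
    then show "graph_diameter ?G \<le> ereal (real d)"
      unfolding graph_diameter_def using dist[of _ _ d] by (auto intro!: SUP_least)
    have "\<not> near n 1 (6 * n + 1)" 
    proof -
      have "(6 * n + 1) div 3 = 2 * n" by presburger
      then show ?thesis using n(1) unfolding near_def by simp
    qed
    then have no_walk: "\<nexists>p. pre_digraph.awalk ?G 1 p (6 * n + 1) \<and> length p \<le> n"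
      using graph_dist_le_iff[OF wf_graph_on, of adj ?V 1 "6 * n + 1" n] dist[of 1 "6 * n + 1" n] by auto
    have "ereal (real d) \<le> graph_dist ?G 1 (6 * n + 1)"
    proof (rule graph_dist_ge[OF wf_graph_on])
      fix p assume "pre_digraph.awalk ?G 1 p (6 * n + 1)"
      with no_walk have "\<not> length p \<le> n" by blast
      then show "d \<le> length p" unfolding n(2) by simp
    qed
    also have "\<dots> \<le> graph_diameter ?G"
      unfolding graph_diameter_def by (rule SUP_upper2[of 1]) (auto intro!: SUP_upper)
    finally show "ereal (real d) \<le> graph_diameter ?G" .
  qed
  moreover have "hamiltonian (graph_ball ?G v r)"
    if v: "v \<in> ?V" and r: "1 \<le> r" and ball: "graph_ball ?G v r \<noteq> ?G" for v r
  proof -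
    let ?B = "{w \<in> ?V. near r v w}"
    have "graph_ball ?G v r = ?G \<restriction> ?B"
      unfolding graph_ball_def using dist[OF v] by (intro arg_cong[where f = "(\<restriction>) ?G"]) auto
    then have B: "graph_ball ?G v r = graph_on adj ?B"
      by (subst (asm) graph_on_restrict) auto
    with ball have "?B \<noteq> ?V" by metis
    then show ?thesis unfolding B by (rule hamiltonian_ball[OF n(1) v r])
  qed
  ultimately show ?thesis by (intro exI[of _ ?G]) simp
qed

end
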